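(* Let $n\ge m\ge 1$ be integers and $G=K_m\Box K_n$. Then $s(G)=cs(G)$.
   Context: For a connected graph $G$ and $X\subseteq V(G)$, $G[X]$ denotes the subgraph induced by $X$. A set $S\subseteq V(G)$ is a safe set if for every component $C$ of $G[S]$ and every component $D$ of $G-S$ such that some edge joins $C$ and $D$, we have $|C|\ge |D|$. If moreover $G[S]$ is connected, $S$ is a connected safe set. The safe number $s(G)$ (resp. connected safe number $cs(G)$) is the minimum size of a safe set (resp. connected safe set) of $G$. $K_m \Box K_n$ has vertex set $[m]\times[n]$, with $(i,j)$ and $(i',j')$ adjacent iff either $i=i'$ and $j\neq j'$, or $j=j'$ and $i\ne i'$. *)

theory Defs
  imports "Graph_Theory.Graph_Theory"
begin

text \<open>Finite simple graphs are the symmetric loop-free digraphs of locale \<^locale>\<open>graph\<close>: an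
  undirected edge is represented by its two arcs.\<close>

definition conn_components :: "('a, 'b) pre_digraph \<Rightarrow> ('a, 'b) pre_digraph set" where
  "conn_components G = {H. pre_digraph.max_subgraph G connected H}"

text \<open>The empty set is excluded: it satisfies the condition on components vacuously, so every safe
  number would otherwise be 0.\<close>

definition safe_set :: "('a, 'b) pre_digraph \<Rightarrow> 'a set \<Rightarrow> bool" where
  "safe_set G S \<longleftrightarrow> S \<noteq> {} \<and> S \<subseteq> verts G \<and>
     (\<forall>C \<in> conn_components (G \<restriction> S). \<forall>D \<in> conn_components (G \<restriction> (verts G - S)).
        (\<exists>u \<in> verts C. \<exists>v \<in> verts D. u \<rightarrow>\<^bsub>G\<^esub> v) \<longrightarrow> card (verts C) \<ge> card (verts D))"

definition connected_safe_set :: "('a, 'b) pre_digraph \<Rightarrow> 'a set \<Rightarrow> bool" where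
  "connected_safe_set G S \<longleftrightarrow> safe_set G S \<and> connected (G \<restriction> S)"

text \<open>The two minima exist for a connected graph, see \<open>connected_safe_set_verts\<close> below.\<close>

definition safe_number :: "('a, 'b) pre_digraph \<Rightarrow> nat" where
  "safe_number G = (LEAST k. \<exists>S. safe_set G S \<and> card S = k)"

definition connected_safe_number :: "('a, 'b) pre_digraph \<Rightarrow> nat" where
  "connected_safe_number G = (LEAST k. \<exists>S. connected_safe_set G S \<and> card S = k)"

text \<open>The Cartesian product of the complete graphs on \<open>{1..m}\<close> and \<open>{1..n}\<close>.\<close>

definition K_box_K :: "nat \<Rightarrow> nat \<Rightarrow> (nat \<times> nat, (nat \<times> nat) \<times> (nat \<times> nat)) pre_digraph" where
  "K_box_K m n = with_proj
     \<lparr> pverts = {1..m} \<times> {1..n},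
       parcs = {((i, j), (i', j')) | i j i' j'.
          (i, j) \<in> {1..m} \<times> {1..n} \<and> (i', j') \<in> {1..m} \<times> {1..n} \<and>
          (i = i' \<and> j \<noteq> j' \<or> j = j' \<and> i \<noteq> i')} \<rparr>"

lemma conn_components_eq_sccs:
  assumes "graph G"
  shows "conn_components G = pre_digraph.sccs G"
proof -
  interpret graph G by fact
  have mono: "arc_mono (connected :: ('a, 'b) pre_digraph \<Rightarrow> bool)"
    unfolding arc_mono_def
    by (metis spanning_def subgraph_def wf_digraph.connected_spanning_imp_connected)
  have sc: "strongly_connected H" if "induced_subgraph H G" "connected H" for H
    using that
    by (meson induced_graph_imp_symmetric induced_imp_subgraph sym_arcs subgraph_def
        wf_digraph.symmetric_connected_imp_strongly_connected)
  have con: "connected H" if "subgraph H G" "strongly_connected H" for H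
    using that unfolding connected_def strongly_connected_def
    by (auto simp: subgraph_def wf_digraph.reachable_mk_symmetricI)
  show ?thesis
  proof (intro set_eqI iffI)
    fix H assume "H \<in> conn_components G"
    then have max: "max_subgraph connected H" by (simp add: conn_components_def)
    then have "induced_subgraph H G" using mono by (rule induced_subgraphI_arc_mono)
    then have "strongly_connected H" using max sc by (auto simp: max_subgraph_def)
    then have "max_subgraph strongly_connected H"
      using max con by (auto simp: max_subgraph_def)
    then show "H \<in> sccs" by (simp add: sccs_altdef2)
  next
    fix H assume H: "H \<in> sccs"
    then have ind: "induced_subgraph H G" and sH: "strongly_connected H"
      and mx: "\<And>H'. induced_subgraph H' G \<Longrightarrow> strongly_connected H' \<Longrightarrow> \<not> verts H \<subset> verts H'"
      by (auto simp: sccs_def)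
    have sub: "subgraph H G" using ind by auto
    have "H' = H" if H': "subgraph H H'" "subgraph H' G" "connected H'" for H'
    proof -
      have ind': "induced_subgraph (G \<restriction> verts H') G"
        using H'(2) by (auto intro: induced_induce)
      have "connected (G \<restriction> verts H')"
        using mono H'(2,3) subgraph_induce_subgraphI2[OF H'(2)]
        unfolding arc_mono_def by (metis induce_subgraph_verts)
      then have "\<not> verts H \<subset> verts H'" using mx[OF ind'] sc[OF ind'] by simp
      moreover have "verts H \<subseteq> verts H'" using H'(1) by (simp add: subgraph_def)
      ultimately have V: "verts H' = verts H" by blast
      have ends: "tail H = tail G" "head H = head G" "tail H' = tail G" "head H' = head G"
        using sub H'(2) by (simp_all add: subgraph_def compatible_def)
      have wf: "wf_digraph H'" and AG: "arcs H' \<subseteq> arcs G" and AH: "arcs H \<subseteq> arcs H'"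
        using H'(1,2) by (simp_all add: subgraph_def)
      have "arcs H = {e \<in> arcs G. tail G e \<in> verts H \<and> head G e \<in> verts H}"
        using ind by (simp add: induced_subgraph_def)
      moreover have "tail G e \<in> verts H \<and> head G e \<in> verts H" if "e \<in> arcs H'" for e
        using wf_digraph.wellformed[OF wf that] V ends by simp
      ultimately have "arcs H' = arcs H" using AG AH by blast
      with V ends show ?thesis by simp
    qed
    then show "H \<in> conn_components G"
      using sub con[OF sub sH] by (auto simp: conn_components_def max_subgraph_def)
  qed
qed

lemma connected_safe_set_verts:
  assumes "wf_digraph G" "connected G"
  shows "connected_safe_set G (verts G)"
proof -
  interpret wf_digraph G by fact
  have "G \<restriction> verts G = G" by (simp add: induce_subgraph_def cong: conj_cong)
  moreover have "verts G \<noteq> {}" using assms by (auto simp: connected_conv)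
  moreover have "conn_components (G \<restriction> {}) = {}"
    by (auto simp: conn_components_def pre_digraph.max_subgraph_def subgraph_def connected_conv)
  ultimately show ?thesis using assms(2) by (simp add: connected_safe_set_def safe_set_def)
qed

lemma graph_K_box_K: "graph (K_box_K m n)"
proof -
  let ?P = "\<lparr> pverts = {1..m} \<times> {1..n},
       parcs = {((i, j), (i', j')) | i j i' j'.
          (i, j) \<in> {1..m} \<times> {1..n} \<and> (i', j') \<in> {1..m} \<times> {1..n} \<and>
          (i = i' \<and> j \<noteq> j' \<or> j = j' \<and> i \<noteq> i')} \<rparr>"
  have "finite (parcs ?P)"
    by (rule finite_subset[of _ "({1..m} \<times> {1..n}) \<times> ({1..m} \<times> {1..n})"]) auto
  then have "pair_graph ?P"
    by unfold_locales (auto simp: symmetric_def intro!: symI)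
  then show ?thesis unfolding K_box_K_def by (rule pair_graph.pair_graphD_graph)
qed

end

theory Submission
  imports Defs
begin

text \<open>A connected set containing at least half of the vertices is safe, and the rook's graph
  \<open>K_box_K m n\<close> has connected sets of every size. So it suffices that a disconnected safe set \<open>S\<close>
  contains at least half of the vertices. Let \<open>A\<close> be a component of \<open>S\<close>, with row set \<open>R\<close> and column
  set \<open>C\<close>; the rest \<open>B\<close> of \<open>S\<close> avoids these rows and columns. If the complement of \<open>S\<close> is connected,
  the claim is immediate. Otherwise the complement is the union of the two blocks \<open>R \<times> -C\<close> and
  \<open>-R \<times> C\<close>, and comparing each of them with a component of \<open>S\<close>, the first with \<open>A\<close> and the second
  with a component inside \<open>B\<close>, bounds the complement by \<open>|A| + |B|\<close>.\<close>

section \<open>Components and safety in a general graph\<close>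

lemma dominates_induce_iff:
  "u \<rightarrow>\<^bsub>G \<restriction> S\<^esub> v \<longleftrightarrow> u \<in> S \<and> v \<in> S \<and> u \<rightarrow>\<^bsub>G\<^esub> v"
  by (auto simp: arcs_ends_conv)

lemma (in graph) graph_induce:
  assumes "S \<subseteq> verts G"
  shows "graph (G \<restriction> S)"
proof -
  have "digraph (G \<restriction> S)" "symmetric (G \<restriction> S)"
    using induced_induce[OF assms] sym_arcs
    by (auto intro: digraphI_induced induced_graph_imp_symmetric)
  then show ?thesis by (rule digraph.graphI)
qed

lemma (in sym_digraph) connectedI_root:
  assumes "r \<in> verts G" "\<And>v. v \<in> verts G \<Longrightarrow> r \<rightarrow>\<^sup>*\<^bsub>G\<^esub> v"
  shows "connected G"
proof -
  have "u \<rightarrow>\<^sup>*\<^bsub>G\<^esub> v" if "u \<in> verts G" "v \<in> verts G" for u v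
    using assms(2)[OF that(1)] assms(2)[OF that(2)]
    by (meson reachable_trans symmetric_reachable sym_arcs)
  then show ?thesis
    using assms(1) unfolding connected_def strongly_connected_def
    by (auto intro: reachable_mk_symmetricI)
qed

text \<open>In a symmetric digraph the vertices reachable from \<open>u\<close> form the component
  of \<open>u\<close>. Safety thus becomes a bound between reachable sets, and component subgraphs
  need not be handled again.\<close>

lemma (in graph) safe_set_card_reachable_le:
  assumes "safe_set G S" "u \<in> S" "v \<in> verts G - S" "u \<rightarrow>\<^bsub>G\<^esub> v"
  shows "card {x. v \<rightarrow>\<^sup>*\<^bsub>G \<restriction> (verts G - S)\<^esub> x} \<le> card {x. u \<rightarrow>\<^sup>*\<^bsub>G \<restriction> S\<^esub> x}"
proof -
  have S: "S \<subseteq> verts G" using assms(1) by (simp add: safe_set_def)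
  interpret HS: graph "G \<restriction> S" by (rule graph_induce[OF S])
  interpret HT: graph "G \<restriction> (verts G - S)" by (rule graph_induce) blast
  let ?C = "(G \<restriction> S) \<restriction> {x. u \<rightarrow>\<^sup>*\<^bsub>G \<restriction> S\<^esub> x}"
  let ?D = "(G \<restriction> (verts G - S)) \<restriction> {x. v \<rightarrow>\<^sup>*\<^bsub>G \<restriction> (verts G - S)\<^esub> x}"
  have "?C \<in> conn_components (G \<restriction> S)" "?D \<in> conn_components (G \<restriction> (verts G - S))"
    using assms HS.induce_reachable_is_in_sccs[of u] HT.induce_reachable_is_in_sccs[of v]
    by (simp_all add: conn_components_eq_sccs HS.graph_axioms HT.graph_axioms)
  moreover have "u \<in> verts ?C" "v \<in> verts ?D" using assms by auto
  ultimately have "card (verts ?D) \<le> card (verts ?C)"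
    using assms(1,4) unfolding safe_set_def by blast
  then show ?thesis by simp
qed

text \<open>The only component of a connected induced subgraph is the subgraph itself, and every
  component outside lies in the complement of \<open>S\<close>, so one comparison of sizes settles
  all pairs.\<close>

lemma (in graph) connected_safe_setI:
  assumes "S \<subseteq> verts G" "connected (G \<restriction> S)" "card (verts G - S) \<le> card S"
  shows "connected_safe_set G S"
proof -
  interpret HS: graph "G \<restriction> S" by (rule graph_induce[OF assms(1)])
  have "S \<noteq> {}" using assms(2) by (auto simp: connected_conv)
  moreover have "card (verts D) \<le> card (verts C)"
    if "C \<in> conn_components (G \<restriction> S)" "D \<in> conn_components (G \<restriction> (verts G - S))" for C D
  proof -
    have "C = G \<restriction> S"
      using that(1) assms(2) HS.subgraph_refl
      by (auto simp: conn_components_def pre_digraph.max_subgraph_def)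
    moreover have "verts D \<subseteq> verts G - S"
      using that(2) by (auto simp: conn_components_def pre_digraph.max_subgraph_def subgraph_def)
    then have "card (verts D) \<le> card (verts G - S)" by (simp add: card_mono)
    ultimately show ?thesis using assms(3) by simp
  qed
  ultimately show ?thesis
    using assms by (auto simp: connected_safe_set_def safe_set_def)
qed

section \<open>Paths and connected sets in the rook's graph\<close>

lemma verts_K_box_K [simp]: "verts (K_box_K m n) = {1..m} \<times> {1..n}"
  by (simp add: K_box_K_def)

lemma dominates_K_box_K:
  "(i, j) \<rightarrow>\<^bsub>K_box_K m n\<^esub> (i', j') \<longleftrightarrow>
     (i, j) \<in> {1..m} \<times> {1..n} \<and> (i', j') \<in> {1..m} \<times> {1..n} \<and>
     (i = i' \<and> j \<noteq> j' \<or> j = j' \<and> i \<noteq> i')"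
  by (auto simp: K_box_K_def arcs_ends_conv)

text \<open>Distinct cells on a common line are adjacent. Stating reachability instead of adjacency
  also covers equal cells, so paths can be composed later without splitting off degenerate
  steps.\<close>

lemma reachable_induce_K_box_K:
  assumes "S \<subseteq> {1..m} \<times> {1..n}" "(i, j) \<in> S" "(i', j') \<in> S" "i = i' \<or> j = j'"
  shows "(i, j) \<rightarrow>\<^sup>*\<^bsub>K_box_K m n \<restriction> S\<^esub> (i', j')"
proof -
  interpret graph "K_box_K m n" by (rule graph_K_box_K)
  interpret H: graph "K_box_K m n \<restriction> S" using assms(1) by (intro graph_induce) simp
  show ?thesis
  proof (cases "(i, j) = (i', j')")
    case False
    then have "(i, j) \<rightarrow>\<^bsub>K_box_K m n \<restriction> S\<^esub> (i', j')"
      using assms by (auto simp: dominates_induce_iff dominates_K_box_K)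
    then show ?thesis by simp
  qed (use assms in auto)
qed

text \<open>The sets grown here contain, with every cell, the first cell of its row. They are therefore
  connected through column 1.\<close>

lemma connected_subset_K_box_K:
  assumes "1 \<le> t" "t \<le> m * n"
  obtains S where "S \<subseteq> {1..m} \<times> {1..n}" "card S = t" "connected (K_box_K m n \<restriction> S)"
proof -
  let ?V = "{1..m} \<times> {1..n}"
  have "\<exists>S. S \<subseteq> ?V \<and> card S = t \<and> (1, 1) \<in> S \<and> (\<forall>(i, j) \<in> S. (i, 1) \<in> S)"
    using assms
  proof (induction t rule: nat_induct_at_least)
    case base
    then have "m \<noteq> 0" "n \<noteq> 0" by (auto intro!: Nat.gr0I)
    then show ?case by (intro exI[of _ "{(1, 1)}"]) auto
  next
    case (Suc t)
    then obtain S where S: "S \<subseteq> ?V" "card S = t" "(1, 1) \<in> S" "\<forall>(i, j) \<in> S. (i, 1) \<in> S"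
      by auto
    have fin: "finite S" using S(1) by (rule finite_subset) simp
    have "S \<noteq> ?V" using S(2) Suc.prems by auto
    then obtain i j where ij: "(i, j) \<in> ?V" "(i, j) \<notin> S" using S(1) by (metis subrelI subset_antisym)
    show ?case
    \<comment> \<open>Adding \<open>(i, j)\<close> preserves the invariant only if the first cell of
      row \<open>i\<close> is already present; otherwise that first cell is itself a legitimate new
      cell.\<close>
    proof (cases "(i, 1) \<in> S")
      case True
      then show ?thesis using S ij fin by (intro exI[of _ "insert (i, j) S"]) auto
    next
      case False
      then show ?thesis using S ij fin by (intro exI[of _ "insert (i, 1) S"]) auto
    qed
  qed
  then obtain S where S: "S \<subseteq> ?V" "card S = t" "(1, 1) \<in> S" "\<forall>(i, j) \<in> S. (i, 1) \<in> S"
    by auto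
  interpret graph "K_box_K m n" by (rule graph_K_box_K)
  interpret H: graph "K_box_K m n \<restriction> S" using S(1) by (intro graph_induce) simp
  have "connected (K_box_K m n \<restriction> S)"
  proof (rule H.connectedI_root)
    show "(1, 1) \<in> verts (K_box_K m n \<restriction> S)" using S(3) by simp
    fix v assume "v \<in> verts (K_box_K m n \<restriction> S)"
    then obtain i j where v: "v = (i, j)" "(i, j) \<in> S" "(i, 1) \<in> S" using S(4) by (cases v) auto
    have "(1, 1) \<rightarrow>\<^sup>*\<^bsub>K_box_K m n \<restriction> S\<^esub> (i, 1)" "(i, 1) \<rightarrow>\<^sup>*\<^bsub>K_box_K m n \<restriction> S\<^esub> (i, j)"
      using reachable_induce_K_box_K[OF S(1)] S(3) v by simp_all
    then show "(1, 1) \<rightarrow>\<^sup>*\<^bsub>K_box_K m n \<restriction> S\<^esub> v" using v(1) by (auto intro: H.reachable_trans)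
  qed
  then show thesis using that S by blast
qed

section \<open>Safe sets with several components\<close>

lemma disconnected_safe_set_K_box_K:
  assumes safe: "safe_set (K_box_K m n) S" and disc: "\<not> connected (K_box_K m n \<restriction> S)"
  shows "card ({1..m} \<times> {1..n} - S) \<le> card S"
proof -
  let ?G = "K_box_K m n"
  define V where "V = {1..m} \<times> {1..n}"
  define T where "T = V - S"
  interpret graph ?G by (rule graph_K_box_K)
  have VG: "verts ?G = V" and finV: "finite V" by (simp_all add: V_def)
  have SV: "S \<subseteq> V" and TV: "T \<subseteq> V" and ne: "S \<noteq> {}"
    using safe by (auto simp: safe_set_def V_def T_def)
  have finS: "finite S" and finT: "finite T" using SV TV finV by (auto intro: finite_subset)
  interpret HS: graph "?G \<restriction> S" using SV VG by (intro graph_induce) simp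
  interpret HT: graph "?G \<restriction> T" using TV VG by (intro graph_induce) simp
  let ?compS = "\<lambda>u. {x. u \<rightarrow>\<^sup>*\<^bsub>?G \<restriction> S\<^esub> x}" and ?compT = "\<lambda>u. {x. u \<rightarrow>\<^sup>*\<^bsub>?G \<restriction> T\<^esub> x}"
  have compS: "?compS u \<subseteq> S" for u by (auto dest!: HS.reachable_in_verts(2))
  have compT: "?compT u \<subseteq> T" for u by (auto dest!: HT.reachable_in_verts(2))
  have le: "card (?compT v) \<le> card (?compS u)"
    if "u \<in> S" "v \<in> T" "fst u = fst v \<or> snd u = snd v" for u v
  proof -
    have "u \<rightarrow>\<^bsub>?G\<^esub> v"
      using that SV by (cases u; cases v) (auto simp: dominates_K_box_K T_def V_def)
    then show ?thesis
      using safe_set_card_reachable_le[OF safe \<open>u \<in> S\<close>, of v] that(2)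
      unfolding VG T_def by blast
  qed
  have reachS: "(i, j) \<rightarrow>\<^sup>*\<^bsub>?G \<restriction> S\<^esub> (i', j')"
    if "(i, j) \<in> S" "(i', j') \<in> S" "i = i' \<or> j = j'" for i j i' j'
    using reachable_induce_K_box_K SV that by (simp add: V_def)
  have reachT: "(i, j) \<rightarrow>\<^sup>*\<^bsub>?G \<restriction> T\<^esub> (i', j')"
    if "(i, j) \<in> T" "(i', j') \<in> T" "i = i' \<or> j = j'" for i j i' j'
    using reachable_induce_K_box_K TV that by (simp add: V_def)
  obtain r c where u: "(r, c) \<in> S" using ne by auto
  define A where "A = ?compS (r, c)"
  define B where "B = S - A"
  define R where "R = fst ` A"
  define C where "C = snd ` A"
  have uA: "(r, c) \<in> A" using u by (simp add: A_def)
  have AS: "A \<subseteq> S" using compS by (simp add: A_def)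
  \<comment> \<open>Two cells of \<open>S\<close> on a common line lie in the same
    component.\<close>
  have apart: "i \<noteq> i' \<and> j \<noteq> j'" if "(i, j) \<in> A" "(i', j') \<in> B" for i j i' j'
    using that reachS[of i j i' j'] AS HS.reachable_trans unfolding A_def B_def by blast
  have B_out: "i \<notin> R \<and> j \<notin> C" if "(i, j) \<in> B" for i j
    using that apart by (force simp: R_def C_def)
  have "B \<noteq> {}"
  proof
    assume "B = {}"
    then have "connected (?G \<restriction> S)"
      using u AS by (intro HS.connectedI_root[of "(r, c)"]) (auto simp: A_def B_def)
    with disc show False by simp
  qed
  then obtain r' c' where b: "(r', c') \<in> B" by auto
  have bS: "(r', c') \<in> S" using b by (simp add: B_def)
  \<comment> \<open>Such a cell is not in \<open>A\<close> because of its column, and not in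
    \<open>B\<close> because of its row.\<close>
  have blockT1: "(i, j) \<in> T" if "i \<in> R" "j \<in> {1..n} - C" for i j
  proof -
    have "(i, j) \<notin> S" using that B_out[of i j] by (force simp: B_def C_def)
    moreover have "i \<in> {1..m}" using that(1) AS SV by (auto simp: R_def V_def)
    ultimately show ?thesis using that by (auto simp: T_def V_def)
  qed
  have blockT2: "(i, j) \<in> T" if "i \<in> {1..m} - R" "j \<in> C" for i j
  proof -
    have "(i, j) \<notin> S" using that B_out[of i j] by (force simp: B_def R_def)
    moreover have "j \<in> {1..n}" using that(2) AS SV by (auto simp: C_def V_def)
    ultimately show ?thesis using that by (auto simp: T_def V_def)
  qed
  have r: "r \<in> R" "c \<in> C" using uA by (force simp: R_def C_def)+
  have r': "r' \<in> {1..m} - R" "c' \<in> {1..n} - C" using B_out[OF b] bS SV by (auto simp: V_def)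
  \<comment> \<open>These two cells represent the blocks \<open>R\<close> \<times> \<open>-C\<close>
    and \<open>-R\<close> \<times> \<open>C\<close>.\<close>
  have X: "(r, c') \<in> T" and Y: "(r', c) \<in> T" using blockT1 blockT2 r r' by blast+
  let ?Q = "\<lambda>u v. u \<rightarrow>\<^sup>*\<^bsub>?G \<restriction> T\<^esub> v"
  have sym: "?Q u v \<Longrightarrow> ?Q v u" for u v by (rule symmetric_reachable[OF HT.sym_arcs])
  note tr = HT.reachable_trans
  \<comment> \<open>The path has at most two moves and turns inside the first block: at
    \<open>(i, c')\<close> if \<open>i\<close> \<in> \<open>R\<close>, and at \<open>(r, j)\<close>
    otherwise.\<close>
  have toX: "?Q (r, c') (i, j)" if "(i, j) \<in> T" "i \<in> R \<or> j \<notin> C" for i j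
  proof (cases "i \<in> R")
    case True
    then have "(i, c') \<in> T" using blockT1 r' by blast
    then show ?thesis using tr[OF reachT[OF X] reachT[OF _ that(1)]] by blast
  next
    case False
    then have "(r, j) \<in> T" using that blockT1 r TV by (auto simp: V_def)
    then show ?thesis using tr[OF reachT[OF X] reachT[OF _ that(1)]] by blast
  qed
  have toY: "?Q (r', c) (i, j)" if "(i, j) \<in> T" "i \<notin> R \<or> j \<in> C" for i j
  proof (cases "j \<in> C")
    case True
    then have "(r', j) \<in> T" using blockT2 r' by blast
    then show ?thesis using tr[OF reachT[OF Y] reachT[OF _ that(1)]] by blast
  next
    case False
    then have "(i, c) \<in> T" using that blockT2 r TV by (auto simp: V_def)
    then show ?thesis using tr[OF reachT[OF Y] reachT[OF _ that(1)]] by blast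
  qed
  have "card T \<le> card S"
  \<comment> \<open>A cell of \<open>T\<close> in \<open>R\<close> \<times> \<open>C\<close> or
    \<open>-R\<close> \<times> \<open>-C\<close> is reachable from both representatives, hence glues
    the two blocks together and makes \<open>T\<close> connected.\<close>
  proof (cases "\<exists>p q. (p, q) \<in> T \<and> (p \<in> R \<longleftrightarrow> q \<in> C)")
    case True
    then obtain p q where pq: "(p, q) \<in> T" "p \<in> R \<longleftrightarrow> q \<in> C" by blast
    have "?Q (r, c') (r', c)" using toX[of p q] toY[of p q] pq tr sym by blast
    then have "?Q (r, c') (i, j)" if "(i, j) \<in> T" for i j
      using toX[of i j] toY[of i j] that tr by blast
    then have "?compT (r, c') = T" by (auto dest: HT.reachable_in_verts(2))
    then have "card T \<le> card (?compS (r, c))" using le[OF u X] by simp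
    also have "\<dots> \<le> card S" using compS finS by (intro card_mono)
    finally show ?thesis .
  next
    case False
    then have "(i, j) \<in> ?compT (r, c') \<union> ?compT (r', c)" if "(i, j) \<in> T" for i j
      using toX[of i j] toY[of i j] that by auto
    then have "card T \<le> card (?compT (r, c') \<union> ?compT (r', c))"
      using finite_subset[OF compT finT] by (intro card_mono) auto
    also have "\<dots> \<le> card (?compT (r, c')) + card (?compT (r', c))" by (rule card_Un_le)
    \<comment> \<open>Each representative is paired with the cell of \<open>S\<close> chosen in its
      row. Comparing both with \<open>A\<close> would only give twice the size of \<open>A\<close>;
      this pairing uses two disjoint components of \<open>S\<close>.\<close>
    also have "\<dots> \<le> card A + card (?compS (r', c'))"
      using le[OF u X] le[OF bS Y] by (simp add: A_def)
    also have "?compS (r', c') \<subseteq> B"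
    proof -
      \<comment> \<open>Reversing the path from \<open>(r', c')\<close> to a cell of
        \<open>A\<close> would put \<open>(r', c')\<close> into \<open>A\<close>.\<close>
      have "x \<notin> A" if "(r', c') \<rightarrow>\<^sup>*\<^bsub>?G \<restriction> S\<^esub> x" for x
        using that b HS.reachable_trans symmetric_reachable[OF HS.sym_arcs that]
        unfolding A_def B_def by blast
      then show ?thesis using compS unfolding B_def by blast
    qed
    then have "card A + card (?compS (r', c')) \<le> card A + card B"
      using finS by (simp add: card_mono B_def)
    also have "\<dots> = card S"
      using AS finS by (simp add: B_def card_Diff_subset card_mono finite_subset)
    finally show ?thesis .
  qed
  then show ?thesis by (simp add: T_def V_def)
qed

section \<open>Passing from safe sets to connected ones\<close>

lemma connected_safe_set_same_card_K_box_K: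
  assumes "safe_set (K_box_K m n) S"
  obtains S' where "connected_safe_set (K_box_K m n) S'" "card S' = card S"
proof (cases "connected (K_box_K m n \<restriction> S)")
  case True
  then show thesis using assms that by (auto simp: connected_safe_set_def)
next
  case False
  let ?V = "{1..m} \<times> {1..n}"
  interpret graph "K_box_K m n" by (rule graph_K_box_K)
  have S: "S \<subseteq> ?V" "S \<noteq> {}" using assms by (auto simp: safe_set_def)
  then have fin: "finite S" by (auto intro: finite_subset)
  have "card S \<le> m * n" using card_mono[OF _ S(1)] by simp
  moreover have "1 \<le> card S" using S(2) fin by (simp add: Suc_le_eq card_gt_0_iff)
  ultimately obtain S' where S': "S' \<subseteq> ?V" "card S' = card S" "connected (K_box_K m n \<restriction> S')"
    using connected_subset_K_box_K by metis
  \<comment> \<open>Only the size of \<open>S\<close> matters here: \<open>S\<close> has at least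
    half of the cells, hence so does \<open>S'\<close>.\<close>
  have "card (?V - S') = card (?V - S)"
    using S S' fin by (simp add: card_Diff_subset finite_subset[of S' ?V])
  then have "card (?V - S') \<le> card S'"
    using disconnected_safe_set_K_box_K[OF assms False] S'(2) by simp
  then show thesis using that connected_safe_setI[of S'] S' by simp
qed

theorem theorem2p10:
  fixes m n :: nat
  assumes "n \<ge> m" and "m \<ge> 1"
  shows "safe_number (K_box_K m n) = connected_safe_number (K_box_K m n)"
proof -
  \<comment> \<open>Safe sets and connected safe sets attain exactly the same sizes, so in
    particular their minima agree.\<close>
  have "(\<exists>S. safe_set (K_box_K m n) S \<and> card S = k) \<longleftrightarrow>
      (\<exists>S. connected_safe_set (K_box_K m n) S \<and> card S = k)" for k
    using connected_safe_set_same_card_K_box_K by (metis connected_safe_set_def)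
  then show ?thesis by (simp add: safe_number_def connected_safe_number_def)
qed

end
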